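(* Let $N\geq 2$ be an integer, and let $d,i$ be positive integers with $i\geq 2$ such that $N=\frac{d(d+i)}{i-1}$. Then $X_{N,d,i}=(A,B)$, where $$A=\frac{-(d+i+1)+\sqrt{(d+i+1)^2+4N}}{2},\qquad B=\frac{-(d+1)+\sqrt{(d-1)^2+4N}}{2}.$$
   Context: For an integer $N\ge 2$ and a real $\alpha$ with $0<\alpha\le\sqrt N-1$, put $I_\alpha=[\alpha,\alpha+1]$ and define $T_\alpha:I_\alpha\to[\alpha,\alpha+1)$ by $T_\alpha(x)=\frac Nx-d(x)$, where $d(x)=\lfloor \frac Nx-\alpha\rfloor$ (the dependence on $N$ is suppressed). The values of $d(\cdot)$ are the digits; they form a finite set of consecutive integers $\{d,d+1,\dots,d+i\}$ with smallest digit $d=d(\alpha+1)$ and largest digit $d+i$. The cylinders are $I_k=\{x\in I_\alpha : d(x)=k\}$; the largest digit is always chosen so that every cylinder is an interval (in the exceptional case that $N/\alpha-\alpha$ is an integer, the single point $\alpha$ is given the digit $N/\alpha-\alpha-1$, so that $T_\alpha(\alpha)=\alpha+1$). The interior of $I_k$ is denoted $I_k^{o}$. For positive integers $d,i$, let $\mathcal A_{N,d,i}$ be the set of all $\alpha\in(0,\sqrt N-1]$ for which $T_\alpha$ has digit set $\{d,d+1,\dots,d+i\}$, and let $X_{N,d,i}=\{\alpha\in\mathcal A_{N,d,i} : T_\alpha(\alpha)\in I_d^{o},\ T_\alpha(\alpha+1)\in I_{d+i}^{o}\}$. *)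

theory Defs
  imports "HOL-Analysis.Analysis"
begin

text \<open>
  The first branch is the exceptional convention at the left endpoint: if \<open>N/\<alpha> - \<alpha>\<close> is an
  integer, the floor would create a digit whose cylinder is the single point \<open>\<alpha>\<close>; instead
  \<open>\<alpha>\<close> is given the next smaller digit.
\<close>

definition cf_digit :: "nat \<Rightarrow> real \<Rightarrow> real \<Rightarrow> int" where
  "cf_digit N \<alpha> x =
     (if x = \<alpha> \<and> real N / \<alpha> - \<alpha> \<in> \<int> then \<lfloor>real N / \<alpha> - \<alpha>\<rfloor> - 1
      else \<lfloor>real N / x - \<alpha>\<rfloor>)"

definition cf_map :: "nat \<Rightarrow> real \<Rightarrow> real \<Rightarrow> real" where
  "cf_map N \<alpha> x = real N / x - real_of_int (cf_digit N \<alpha> x)"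

definition cf_cylinder :: "nat \<Rightarrow> real \<Rightarrow> int \<Rightarrow> real set" where
  "cf_cylinder N \<alpha> k = {x \<in> {\<alpha>..\<alpha> + 1}. cf_digit N \<alpha> x = k}"

definition cf_params :: "nat \<Rightarrow> nat \<Rightarrow> nat \<Rightarrow> real set" where
  "cf_params N d i =
     {\<alpha>. 0 < \<alpha> \<and> \<alpha> \<le> sqrt (real N) - 1 \<and>
         cf_digit N \<alpha> ` {\<alpha>..\<alpha> + 1} = {int d..int d + int i}}"

text \<open>
  Interiors of cylinders are taken in \<open>\<real>\<close>, not relative to \<open>{\<alpha>..\<alpha> + 1}\<close>, so the endpoints
  \<open>\<alpha>\<close> and \<open>\<alpha> + 1\<close> never lie in them.
\<close>

definition cf_X :: "nat \<Rightarrow> nat \<Rightarrow> nat \<Rightarrow> real set" where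
  "cf_X N d i =
     {\<alpha> \<in> cf_params N d i.
        cf_map N \<alpha> \<alpha> \<in> interior (cf_cylinder N \<alpha> (int d)) \<and>
        cf_map N \<alpha> (\<alpha> + 1) \<in> interior (cf_cylinder N \<alpha> (int d + int i))}"

end

theory Submission
  imports Defs
begin

text \<open>
  Write \<open>e = d + i\<close> for the largest digit. The number \<open>A\<close> is the positive solution of
  \<open>N/A - e = A + 1\<close> and \<open>B\<close> is the larger solution of \<open>N/(B + 1) - d = B\<close>. For positive
  \<open>\<alpha>\<close> the interval \<open>A < \<alpha> < B\<close> therefore says exactly that \<open>N/\<alpha> - e < \<alpha> + 1\<close> and
  \<open>\<alpha> < N/(\<alpha> + 1) - d\<close>.

  These two inequalities are necessary for any \<open>N\<close>, \<open>d\<close>, \<open>i\<close>: interiors of cylinders lie in the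
  open interval from \<open>\<alpha>\<close> to \<open>\<alpha> + 1\<close>, and the digits of the endpoints lie between \<open>d\<close> and \<open>e\<close>
  (lemma \<open>cf_X_imp_bounds\<close>).

  The hypothesis on \<open>N\<close>, in the form \<open>N (i - 1) = d e\<close>, is what makes them sufficient. The inner
  ends of the extreme cylinders are \<open>N/(\<alpha> + d + 1)\<close> and \<open>N/(\<alpha> + e)\<close>, so one needs
  \<open>N/(\<alpha> + d + 1) < N/\<alpha> - e\<close> and \<open>N/(\<alpha> + 1) - d < N/(\<alpha> + e)\<close>. After clearing denominators,
  the first of these holds for \<open>\<alpha>\<close> below some threshold and the second for \<open>\<alpha>\<close> above some
  threshold; under \<open>N (i - 1) = d e\<close> these thresholds are precisely \<open>B\<close> and \<open>A\<close>
  (lemma \<open>endpoint_images_beyond_inner_ends\<close>). All remaining requirements, in particular that the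
  digit set is the full range from \<open>d\<close> to \<open>e\<close>, follow from these inequalities
  (lemma \<open>cf_X_I\<close>).
\<close>

section \<open>Comparison with the larger root of a quadratic\<close>

lemma quadratic_root_less_iff:
  fixes b c x :: real
  assumes "0 \<le> 2 * x + b"
  shows "(- b + sqrt (b\<^sup>2 + 4 * c)) / 2 < x \<longleftrightarrow> c < x * (x + b)"
proof -
  have "(- b + sqrt (b\<^sup>2 + 4 * c)) / 2 < x \<longleftrightarrow> sqrt (b\<^sup>2 + 4 * c) < sqrt ((2 * x + b)\<^sup>2)"
    using assms by auto
  also have "\<dots> \<longleftrightarrow> c < x * (x + b)"
    unfolding real_sqrt_less_iff by (auto simp: power2_eq_square algebra_simps)
  finally show ?thesis .
qed

lemma less_quadratic_root_iff:
  fixes b c x :: real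
  assumes "0 \<le> 2 * x + b"
  shows "x < (- b + sqrt (b\<^sup>2 + 4 * c)) / 2 \<longleftrightarrow> x * (x + b) < c"
proof -
  have "x < (- b + sqrt (b\<^sup>2 + 4 * c)) / 2 \<longleftrightarrow> sqrt ((2 * x + b)\<^sup>2) < sqrt (b\<^sup>2 + 4 * c)"
    using assms by auto
  also have "\<dots> \<longleftrightarrow> x * (x + b) < c"
    unfolding real_sqrt_less_iff by (auto simp: power2_eq_square algebra_simps)
  finally show ?thesis .
qed

section \<open>Necessary conditions\<close>

lemma interior_cf_cylinder_subset: "interior (cf_cylinder N \<alpha> k) \<subseteq> {\<alpha><..<\<alpha> + 1}"
proof -
  have "interior (cf_cylinder N \<alpha> k) \<subseteq> interior {\<alpha>..\<alpha> + 1}"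
    by (rule interior_mono) (auto simp: cf_cylinder_def)
  then show ?thesis by simp
qed

text \<open>
  The image of \<open>\<alpha>\<close> is less than \<open>\<alpha> + 1\<close> and the image of \<open>\<alpha> + 1\<close> exceeds \<open>\<alpha>\<close>, because interiors
  of cylinders lie strictly between the endpoints. Replacing the digit of \<open>\<alpha>\<close> by its upper bound \<open>d + i\<close> and
  that of \<open>\<alpha> + 1\<close> by its lower bound \<open>d\<close> treats the exceptional digit of \<open>\<alpha>\<close> uniformly with
  the others.
\<close>

lemma cf_X_imp_bounds:
  assumes "\<alpha> \<in> cf_X N d i"
  shows "0 < \<alpha>"
    and "real N < \<alpha> * (\<alpha> + (real d + real i + 1))"
    and "(\<alpha> + 1) * (\<alpha> + real d) < real N"
proof -
  from assms have pos: "0 < \<alpha>"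
    and digits: "cf_digit N \<alpha> ` {\<alpha>..\<alpha> + 1} = {int d..int d + int i}"
    and left: "cf_map N \<alpha> \<alpha> < \<alpha> + 1" and right: "\<alpha> < cf_map N \<alpha> (\<alpha> + 1)"
    using interior_cf_cylinder_subset by (fastforce simp: cf_X_def cf_params_def)+
  show "0 < \<alpha>" by (fact pos)
  have "cf_digit N \<alpha> \<alpha> \<le> int d + int i" and "int d \<le> cf_digit N \<alpha> (\<alpha> + 1)"
    using digits by fastforce+
  then have "of_int (cf_digit N \<alpha> \<alpha>) \<le> real d + real i"
    and "real d \<le> of_int (cf_digit N \<alpha> (\<alpha> + 1))"
    by linarith+
  with left right have "real N / \<alpha> < \<alpha> + (real d + real i + 1)"
    and "\<alpha> + real d < real N / (\<alpha> + 1)"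
    unfolding cf_map_def by linarith+
  with pos show "real N < \<alpha> * (\<alpha> + (real d + real i + 1))"
    and "(\<alpha> + 1) * (\<alpha> + real d) < real N"
    by (simp_all add: pos_divide_less_eq pos_less_divide_eq mult.commute)
qed

section \<open>Sufficient conditions\<close>

text \<open>
  The first two hypotheses keep the images of the endpoints inside the open interval from \<open>\<alpha>\<close> to
  \<open>\<alpha> + 1\<close>; the last two put them beyond the inner ends of the extreme cylinders. The digit
  of \<open>\<alpha>\<close> comes out as \<open>e\<close> without the exceptional convention, because the hypotheses place
  \<open>N/\<alpha> - \<alpha>\<close> strictly between \<open>e\<close> and \<open>e + 1\<close>.
\<close>

lemma cf_X_I:
  fixes N d i :: nat and \<alpha> e :: real
  defines "e \<equiv> real d + real i"
  assumes pos: "0 < \<alpha>" and d: "1 \<le> d"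
    and above: "real N < \<alpha> * (\<alpha> + (e + 1))"
    and below: "(\<alpha> + 1) * (\<alpha> + real d) < real N"
    and left: "real N / (\<alpha> + real d + 1) < real N / \<alpha> - e"
    and right: "real N / (\<alpha> + 1) - real d < real N / (\<alpha> + e)"
  shows "\<alpha> \<in> cf_X N d i"
proof -
  have e_nonneg: "0 \<le> e" by (simp add: e_def)
  have N_pos: "0 < real N"
    using below pos by (smt (verit) mult_nonneg_nonneg of_nat_0_le_iff)
  have left_less: "real N / \<alpha> < \<alpha> + e + 1"
    using above pos by (simp add: pos_divide_less_eq algebra_simps)
  have right_greater: "\<alpha> + real d < real N / (\<alpha> + 1)"
    using below pos by (simp add: pos_less_divide_eq algebra_simps)
  \<comment> \<open>Each inner end stays short of the endpoint opposite to its cylinder; combined with \<open>left\<close> and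
      \<open>right\<close> this gives the missing bounds for the digits of the endpoints.\<close>
  have inner_d: "\<alpha> < real N / (\<alpha> + real d + 1)"
    using below pos by (simp add: pos_less_divide_eq algebra_simps)
  have inner_e: "real N / (\<alpha> + e) < \<alpha> + 1"
  proof -
    have "real N < (\<alpha> + 1) * (\<alpha> + e)"
      using above d by (simp add: e_def algebra_simps)
    then show ?thesis using pos e_nonneg by (simp add: pos_divide_less_eq)
  qed
  have left_greater: "\<alpha> + e < real N / \<alpha>" using left inner_d by linarith
  have right_less: "real N / (\<alpha> + 1) < \<alpha> + real d + 1" using right inner_e by linarith

  have digit_\<alpha>: "cf_digit N \<alpha> \<alpha> = int d + int i"
  proof -
    have fl: "\<lfloor>real N / \<alpha> - \<alpha>\<rfloor> = int d + int i"
      using left_greater left_less by (simp add: floor_eq_iff e_def)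
    have "real N / \<alpha> - \<alpha> \<notin> \<int>"
    proof
      assume "real N / \<alpha> - \<alpha> \<in> \<int>"
      then have "of_int \<lfloor>real N / \<alpha> - \<alpha>\<rfloor> = real N / \<alpha> - \<alpha>" by simp
      then show False using fl left_greater by (simp add: e_def)
    qed
    then show ?thesis using fl by (simp add: cf_digit_def)
  qed
  have digit: "cf_digit N \<alpha> x = \<lfloor>real N / x - \<alpha>\<rfloor>" if "\<alpha> < x" for x
    using that by (simp add: cf_digit_def)
  have digit_right: "cf_digit N \<alpha> (\<alpha> + 1) = int d"
    using right_greater right_less by (simp add: digit floor_eq_iff)

  have range: "cf_digit N \<alpha> x \<in> {int d..int d + int i}" if x: "x \<in> {\<alpha>..\<alpha> + 1}" for x
  proof (cases "x = \<alpha>")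
    case True
    then show ?thesis by (simp add: digit_\<alpha>)
  next
    case False
    have "real N / (\<alpha> + 1) \<le> real N / x" "real N / x \<le> real N / \<alpha>"
      using x pos by (auto intro!: divide_left_mono)
    then have "real d \<le> real N / x - \<alpha>" "real N / x - \<alpha> < real d + real i + 1"
      using right_greater left_less by (simp_all add: e_def)
    then have "int d \<le> \<lfloor>real N / x - \<alpha>\<rfloor>" "\<lfloor>real N / x - \<alpha>\<rfloor> < int d + int i + 1"
      by (simp_all add: le_floor_iff) linarith
    then show ?thesis using False x by (simp add: digit)
  qed
  have attained: "k \<in> cf_digit N \<alpha> ` {\<alpha>..\<alpha> + 1}" if k: "k \<in> {int d..int d + int i}" for k
  proof (cases "k = int d")
    case True
    have "\<alpha> + 1 \<in> {\<alpha>..\<alpha> + 1}" by simp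
    then have "cf_digit N \<alpha> (\<alpha> + 1) \<in> cf_digit N \<alpha> ` {\<alpha>..\<alpha> + 1}" by (rule imageI)
    then show ?thesis unfolding digit_right True .
  next
    case False
    \<comment> \<open>The point mapped to \<open>\<alpha>\<close> by the branch with digit \<open>k\<close>.\<close>
    define x where "x = real N / (\<alpha> + of_int k)"
    have "int d + 1 \<le> k" "k \<le> int d + int i" using k False by auto
    then have k_bounds: "real d + 1 \<le> of_int k" "of_int k \<le> e"
      unfolding e_def by linarith+
    have x_gt: "\<alpha> < x"
    proof -
      have "\<alpha> * (\<alpha> + of_int k) \<le> \<alpha> * (\<alpha> + e)"
        using k_bounds pos by (intro mult_left_mono) auto
      also have "\<dots> < real N"
        using left_greater pos by (simp add: pos_less_divide_eq mult.commute)
      finally show ?thesis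
        unfolding x_def using k_bounds pos by (simp add: pos_less_divide_eq)
    qed
    have x_le: "x \<le> \<alpha> + 1"
    proof -
      have "real N \<le> (\<alpha> + 1) * (\<alpha> + real d + 1)"
        using right_less pos by (simp add: pos_divide_less_eq mult.commute)
      also have "\<dots> \<le> (\<alpha> + 1) * (\<alpha> + of_int k)"
        using k_bounds pos by (intro mult_left_mono) auto
      finally show ?thesis
        unfolding x_def using k_bounds pos by (simp add: pos_divide_le_eq)
    qed
    have "real N / x = \<alpha> + of_int k"
      using N_pos k_bounds pos by (simp add: x_def)
    then have "cf_digit N \<alpha> x = k" using x_gt by (simp add: digit)
    then show ?thesis using x_gt x_le by force
  qed
  have "\<alpha> + 1 \<le> sqrt (real N)"
  proof (rule real_le_rsqrt)
    have "(\<alpha> + 1)\<^sup>2 \<le> (\<alpha> + 1) * (\<alpha> + real d)"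
      unfolding power2_eq_square using d pos by (intro mult_left_mono) auto
    then show "(\<alpha> + 1)\<^sup>2 \<le> real N" using below by simp
  qed
  then have params: "\<alpha> \<in> cf_params N d i"
    unfolding cf_params_def using pos range attained by auto

  have cyl_d: "{real N / (\<alpha> + real d + 1)<..<\<alpha> + 1} \<subseteq> cf_cylinder N \<alpha> (int d)"
  proof
    fix x assume x: "x \<in> {real N / (\<alpha> + real d + 1)<..<\<alpha> + 1}"
    then have "\<alpha> < x" using inner_d by simp
    moreover have "real N / x < \<alpha> + real d + 1"
      using x pos \<open>\<alpha> < x\<close> by (simp add: pos_divide_less_eq mult.commute)
    moreover have "real N / (\<alpha> + 1) \<le> real N / x"
      using x pos \<open>\<alpha> < x\<close> by (intro divide_left_mono) auto
    ultimately show "x \<in> cf_cylinder N \<alpha> (int d)"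
      using x right_greater by (simp add: cf_cylinder_def digit floor_eq_iff)
  qed
  have cyl_e: "{\<alpha><..<real N / (\<alpha> + e)} \<subseteq> cf_cylinder N \<alpha> (int d + int i)"
  proof
    fix x assume x: "x \<in> {\<alpha><..<real N / (\<alpha> + e)}"
    have "\<alpha> + e < real N / x"
      using x pos e_nonneg by (simp add: pos_less_divide_eq mult.commute)
    moreover have "real N / x \<le> real N / \<alpha>"
      using x pos by (intro divide_left_mono) auto
    ultimately show "x \<in> cf_cylinder N \<alpha> (int d + int i)"
      using x inner_e left_less by (simp add: cf_cylinder_def digit floor_eq_iff e_def)
  qed
  have "cf_map N \<alpha> \<alpha> \<in> {real N / (\<alpha> + real d + 1)<..<\<alpha> + 1}"
    using left left_less by (simp add: cf_map_def digit_\<alpha> e_def)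
  moreover have "cf_map N \<alpha> (\<alpha> + 1) \<in> {\<alpha><..<real N / (\<alpha> + e)}"
    using right right_greater by (simp add: cf_map_def digit_right)
  ultimately have "cf_map N \<alpha> \<alpha> \<in> interior (cf_cylinder N \<alpha> (int d))"
    and "cf_map N \<alpha> (\<alpha> + 1) \<in> interior (cf_cylinder N \<alpha> (int d + int i))"
    using interior_maximal[OF cyl_d] interior_maximal[OF cyl_e] by auto
  then show ?thesis using params by (simp add: cf_X_def)
qed

section \<open>The critical value of N\<close>

text \<open>
  Cleared of denominators, the two conclusions read \<open>e \<alpha> (\<alpha> + d + 1) < N (d + 1)\<close> and
  \<open>N (e - 1) < d (\<alpha> + 1) (\<alpha> + e)\<close>. The bounds on \<open>\<alpha>\<close> give \<open>\<alpha> (\<alpha> + d + 1) < N - d\<close> and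
  \<open>(\<alpha> + 1) (\<alpha> + e) > N + e\<close>, and the identity \<open>N (e - d - 1) = d e\<close> is equivalent to each of
  \<open>e (N - d) = N (d + 1)\<close> and \<open>N (e - 1) = d (N + e)\<close>.
\<close>

lemma endpoint_images_beyond_inner_ends:
  fixes N d e \<alpha> :: real
  assumes pos: "0 < \<alpha>" "0 < d" "0 < e"
    and critical: "N * (e - d - 1) = d * e"
    and above: "N < \<alpha> * (\<alpha> + (e + 1))"
    and below: "(\<alpha> + 1) * (\<alpha> + d) < N"
  shows "N / (\<alpha> + d + 1) < N / \<alpha> - e"
    and "N / (\<alpha> + 1) - d < N / (\<alpha> + e)"
proof -
  have "e * (\<alpha> * (\<alpha> + d + 1)) < e * (N - d)"
    using below pos by (intro mult_strict_left_mono) (simp_all add: algebra_simps)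
  also have "\<dots> = N * (d + 1)" using critical by (simp add: algebra_simps)
  finally have "e < N * (d + 1) / (\<alpha> * (\<alpha> + d + 1))"
    using pos by (simp add: pos_less_divide_eq)
  also have "\<dots> = N / \<alpha> - N / (\<alpha> + d + 1)"
    using pos by (simp add: divide_simps) (simp add: algebra_simps)
  finally show "N / (\<alpha> + d + 1) < N / \<alpha> - e" by linarith

  have "N * (e - 1) = d * (N + e)" using critical by (simp add: algebra_simps)
  also have "\<dots> < d * ((\<alpha> + 1) * (\<alpha> + e))"
    using above pos by (intro mult_strict_left_mono) (simp_all add: algebra_simps)
  finally have "N * (e - 1) / ((\<alpha> + 1) * (\<alpha> + e)) < d"
    using pos by (simp add: pos_divide_less_eq)
  moreover have "N * (e - 1) / ((\<alpha> + 1) * (\<alpha> + e)) = N / (\<alpha> + 1) - N / (\<alpha> + e)"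
    using pos by (simp add: divide_simps) (simp add: algebra_simps)
  ultimately show "N / (\<alpha> + 1) - d < N / (\<alpha> + e)" by linarith
qed

theorem theorem5:
  fixes N d i :: nat
  assumes "N \<ge> 2" and "d \<ge> 1" and "i \<ge> 2"
    and "real N = real d * (real d + real i) / (real i - 1)"
  shows "cf_X N d i =
    {(- (real d + real i + 1) + sqrt ((real d + real i + 1)\<^sup>2 + 4 * real N)) / 2
     <..<
     (- (real d + 1) + sqrt ((real d - 1)\<^sup>2 + 4 * real N)) / 2}"
    (is "_ = {?A<..<?B}")
proof -
  have critical: "real N * ((real d + real i) - real d - 1) = real d * (real d + real i)"
    using assms(3,4) by (simp add: field_simps)
  have A_nonneg: "0 \<le> ?A"
    using real_le_rsqrt[of "real d + real i + 1" "(real d + real i + 1)\<^sup>2 + 4 * real N"] by simp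
  have A_less: "?A < \<alpha> \<longleftrightarrow> real N < \<alpha> * (\<alpha> + (real d + real i + 1))" if "0 < \<alpha>" for \<alpha>
    using that by (intro quadratic_root_less_iff) simp
  have less_B: "\<alpha> < ?B \<longleftrightarrow> (\<alpha> + 1) * (\<alpha> + real d) < real N" if "0 < \<alpha>" for \<alpha>
  proof -
    \<comment> \<open>The discriminant in standard form, for the quadratic \<open>x (x + (d + 1)) = N - d\<close>.\<close>
    have discriminant: "(real d - 1)\<^sup>2 + 4 * real N = (real d + 1)\<^sup>2 + 4 * (real N - real d)"
      by (simp add: power2_eq_square algebra_simps)
    have "\<alpha> < ?B \<longleftrightarrow> \<alpha> * (\<alpha> + (real d + 1)) < real N - real d"
      unfolding discriminant using that by (intro less_quadratic_root_iff) simp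
    then show ?thesis by (simp add: algebra_simps)
  qed
  have "\<alpha> \<in> cf_X N d i \<longleftrightarrow> ?A < \<alpha> \<and> \<alpha> < ?B" for \<alpha>
  proof
    assume "\<alpha> \<in> cf_X N d i"
    from cf_X_imp_bounds[OF this] show "?A < \<alpha> \<and> \<alpha> < ?B"
      using A_less less_B by blast
  next
    assume \<alpha>: "?A < \<alpha> \<and> \<alpha> < ?B"
    then have pos: "0 < \<alpha>" using A_nonneg by linarith
    have above: "real N < \<alpha> * (\<alpha> + (real d + real i + 1))"
      and below: "(\<alpha> + 1) * (\<alpha> + real d) < real N"
      using \<alpha> A_less[OF pos] less_B[OF pos] by blast+
    have "0 < real d" "0 < real d + real i" using assms(2) by simp_all
    note ends = endpoint_images_beyond_inner_ends[OF pos this critical above below]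
    show "\<alpha> \<in> cf_X N d i" by (rule cf_X_I[OF pos assms(2) above below ends])
  qed
  then show ?thesis by (intro set_eqI) (simp only: greaterThanLessThan_iff)
qed

end
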